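(* Let $0\le a<b<\infty$, let $p$ be a probability density supported on $[a,b]$ that is non-increasing on $[a,b]$, and let $V:[0,\infty)\to[0,\infty)$ be increasing and concave with $V(0)=0$. Define $\mathcal K:[0,b]\to[0,\infty)$ by $$\mathcal K(s)=\mathbb E_{f\sim p}\big[V\big((f-s)^+\big)\big]=\int_a^b V\big((f-s)^+\big)\,p(f)\,df .$$ Then $\mathcal K$ is non-increasing on $[0,b]$, concave on $[0,a]$, and convex on $[a,b]$.
   Context: Notation: $(x)^+=\max(x,0)$. *)

theory Defs
  imports "HOL-Probability.Probability"
begin

definition prob_density_on :: "(real \<Rightarrow> real) \<Rightarrow> real \<Rightarrow> real \<Rightarrow> bool" where
  "prob_density_on p a b \<longleftrightarrow>
     p \<in> borel_measurable borel \<and> (\<forall>x. 0 \<le> p x) \<and> (\<forall>x. x \<notin> {a..b} \<longrightarrow> p x = 0) \<and>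
     (\<integral>\<^sup>+ x. ennreal (p x) \<partial>lborel) = 1"

definition \<K> :: "(real \<Rightarrow> real) \<Rightarrow> (real \<Rightarrow> real) \<Rightarrow> real \<Rightarrow> real" where
  "\<K> p V s = prob_space.expectation (density lborel p) (\<lambda>f. V (max (f - s) 0))"

lemma prob_space_density_on:
  assumes "prob_density_on p a b"
  shows "prob_space (density lborel p)"
proof
  have [measurable]: "p \<in> borel_measurable borel"
    using assms by (simp add: prob_density_on_def)
  show "emeasure (density lborel p) (space (density lborel p)) = 1"
    using assms by (simp add: prob_density_on_def emeasure_density)
qed

lemma measurable_V_pos_part:
  fixes V :: "real \<Rightarrow> real"
  assumes "mono_on {0..} V"
  shows "(\<lambda>f. V (max (f - s) 0)) \<in> borel_measurable borel"
  by (rule borel_measurable_mono) (auto intro!: monoI mono_onD[OF assms])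

text \<open>The expectation is never the default value of a divergent integral, and it is the
  integral over \<open>[a, b]\<close> against \<open>p\<close>.\<close>

lemma integrable_V_pos_part:
  fixes V :: "real \<Rightarrow> real"
  assumes p: "prob_density_on p a b" and V: "mono_on {0..} V"
    and nn: "\<And>x. 0 \<le> x \<Longrightarrow> 0 \<le> V x"
  shows "integrable (density lborel p) (\<lambda>f. V (max (f - s) 0))"
proof -
  interpret prob_space "density lborel p" by (rule prob_space_density_on[OF p])
  have pm [measurable]: "p \<in> borel_measurable borel"
    using p by (simp add: prob_density_on_def)
  have "AE f in density lborel p. norm (V (max (f - s) 0)) \<le> V (max (b - s) 0)"
  proof (subst AE_density, measurable, rule AE_I2, rule impI)
    fix f assume "0 < ennreal (p f)"
    then have "f \<in> {a..b}"
      using p unfolding prob_density_on_def by (metis ennreal_0 less_irrefl)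
    then show "norm (V (max (f - s) 0)) \<le> V (max (b - s) 0)"
      using nn[of "max (f - s) 0"] by (auto intro!: mono_onD[OF V])
  qed
  then show ?thesis
    by (rule integrable_const_bound) (use measurable_V_pos_part[OF V] in simp)
qed

lemma \<K>_eq_integral:
  assumes p: "prob_density_on p a b" and V: "mono_on {0..} V"
  shows "\<K> p V s = (LINT f:{a..b}|lborel. V (max (f - s) 0) * p f)"
proof -
  have [measurable]: "p \<in> borel_measurable borel" and nn: "\<And>x. 0 \<le> p x"
    and supp: "\<And>x. p x \<noteq> 0 \<Longrightarrow> a \<le> x \<and> x \<le> b"
    using p unfolding prob_density_on_def by (blast, blast, meson atLeastAtMost_iff)
  note [measurable] = measurable_V_pos_part[OF V]
  have "\<K> p V s = (LINT f|lborel. p f *\<^sub>R V (max (f - s) 0))"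
    unfolding \<K>_def by (rule integral_density) (auto simp: nn)
  also have "\<dots> = (LINT f:{a..b}|lborel. V (max (f - s) 0) * p f)"
    unfolding set_lebesgue_integral_def
    by (rule Bochner_Integration.integral_cong) (auto dest: supp simp: indicator_def)
  finally show ?thesis .
qed

lemma \<K>_nonneg:
  assumes "\<And>x. 0 \<le> x \<Longrightarrow> 0 \<le> V x"
  shows "0 \<le> \<K> p V s"
  unfolding \<K>_def by (rule Bochner_Integration.integral_nonneg) (simp add: assms)

end

theory Submission
  imports Defs
begin

text \<open>
  Write \<open>W x = V (max x 0)\<close>, so that \<open>\<K> p V s\<close> is the expectation of \<open>W (f - s)\<close>.  Monotonicity
  in \<open>s\<close> holds for every fixed \<open>f\<close>.  So does concavity on \<open>[0, a]\<close>: there \<open>f - s \<ge> 0\<close> for almost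
  every \<open>f\<close>, hence the positive part disappears and \<open>s \<mapsto> V (f - s)\<close> is concave.

  Convexity on \<open>[a, b]\<close> is not a pointwise property; it comes from the shape of \<open>p\<close>.  The layer-cake
  formula gives \<open>\<K> p V s = \<integral>\<^sub>0\<^sup>\<infinity> P (W (f - s) > t) dt\<close>
  (\<open>nn_integral_layer_cake\<close>), so it is enough that each probability
  in the integrand is convex in \<open>s\<close>.  Since \<open>W\<close> is monotone and vanishes on the negative half-line,
  \<open>{x. W x > t}\<close> is empty or a ray starting at some \<open>c \<ge> 0\<close>, and the probability is the tail
  \<open>P (f > s + c)\<close> (\<open>convex_on_prob_shift_up_closed\<close>).  A tail has derivative \<open>- p\<close>, which is
  non-decreasing on \<open>[a, \<infinity>)\<close>, so the tail is convex there (\<open>convex_on_tail\<close>).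
\<close>

section \<open>The layer-cake formula\<close>

text \<open>Both sides are the measure of the region \<open>{(x, t). 0 \<le> t < g x}\<close> under the graph of \<open>g\<close>.\<close>

lemma nn_integral_layer_cake:
  fixes g :: "'a \<Rightarrow> real"
  assumes "sigma_finite_measure M" and [measurable]: "g \<in> borel_measurable M"
    and nonneg: "\<And>x. 0 \<le> g x"
  shows "(\<integral>\<^sup>+ x. ennreal (g x) \<partial>M)
    = (\<integral>\<^sup>+ t. emeasure M {x \<in> space M. t < g x} * indicator {0..} t \<partial>lborel)"
proof -
  interpret M: sigma_finite_measure M by fact
  interpret pair_sigma_finite M lborel ..
  have "(\<integral>\<^sup>+ x. ennreal (g x) \<partial>M)
      = (\<integral>\<^sup>+ x. \<integral>\<^sup>+ t. indicator {0..<g x} t \<partial>lborel \<partial>M)"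
    using nonneg by simp
  also have "\<dots> = (\<integral>\<^sup>+ x. \<integral>\<^sup>+ t. (if 0 \<le> t \<and> t < g x then 1 else 0) \<partial>lborel \<partial>M)"
    by (intro nn_integral_cong) (auto simp: indicator_def)
  also have "\<dots> = (\<integral>\<^sup>+ t. \<integral>\<^sup>+ x. (if 0 \<le> t \<and> t < g x then 1 else 0) \<partial>M \<partial>lborel)"
    by (rule Fubini'[symmetric]) measurable
  also have "\<dots> = (\<integral>\<^sup>+ t. \<integral>\<^sup>+ x. indicator {0..} t * indicator {x \<in> space M. t < g x} x \<partial>M \<partial>lborel)"
    by (intro nn_integral_cong) (auto simp: indicator_def)
  also have "\<dots> = (\<integral>\<^sup>+ t. emeasure M {x \<in> space M. t < g x} * indicator {0..} t \<partial>lborel)"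
    by (intro nn_integral_cong) (simp add: nn_integral_cmult mult.commute)
  finally show ?thesis .
qed

section \<open>Convexity of tail probabilities\<close>

lemma convex_on_subgradient:
  fixes g m :: "real \<Rightarrow> real"
  assumes "convex S" and sub: "\<And>x z. x \<in> S \<Longrightarrow> z \<in> S \<Longrightarrow> g z + m z * (x - z) \<le> g x"
  shows "convex_on S g"
proof (rule convex_onI)
  fix t x y :: real
  assume t: "0 < t" "t < 1" and xy: "x \<in> S" "y \<in> S"
  define z where "z = (1 - t) *\<^sub>R x + t *\<^sub>R y"
  have "z \<in> S"
    unfolding z_def using t xy \<open>convex S\<close> by (intro convexD) auto
  then have "(1 - t) * (g z + m z * (x - z)) + t * (g z + m z * (y - z)) \<le> (1 - t) * g x + t * g y"
    using t xy by (intro add_mono mult_left_mono sub) auto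
  moreover have "(1 - t) * (g z + m z * (x - z)) + t * (g z + m z * (y - z)) = g z"
    by (simp add: z_def algebra_simps)
  ultimately show "g ((1 - t) *\<^sub>R x + t *\<^sub>R y) \<le> (1 - t) * g x + t * g y"
    by (simp add: z_def)
qed fact

text \<open>
  A monotone \<open>p\<close> may jump, so the tail need not be differentiable.  Bounding \<open>p\<close> on the interval between
  \<open>x\<close> and \<open>z\<close> by its value at \<open>z\<close> still shows that \<open>- p z\<close> is a subgradient at \<open>z\<close>.
\<close>
lemma convex_on_tail:
  fixes p :: "real \<Rightarrow> real"
  assumes "finite_measure (density lborel p)" and [measurable]: "p \<in> borel_measurable borel"
    and nonneg: "\<And>x. 0 \<le> p x" and anti: "antimono_on {a..} p"
  shows "convex_on {a..} (\<lambda>x. measure (density lborel p) {x<..})"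
proof (rule convex_on_subgradient[where m = "\<lambda>z. - p z"])
  let ?D = "density lborel p"
  interpret finite_measure ?D by fact
  have diff: "measure ?D {x<..} - measure ?D {y<..} = measure ?D {x<..y}" if "x \<le> y" for x y
  proof -
    have "{x<..} - {y<..} = {x<..y}" by auto
    then show ?thesis
      using that finite_measure_Diff[of "{x<..}" "{y<..}"] by simp
  qed
  have lower: "p y * (y - x) \<le> measure ?D {x<..y}" if "a \<le> x" "x \<le> y" for x y
  proof -
    have "ennreal (p y * (y - x)) = (\<integral>\<^sup>+ u. ennreal (p y) * indicator {x<..y} u \<partial>lborel)"
      using that nonneg by (simp add: nn_integral_cmult ennreal_mult)
    also have "\<dots> \<le> (\<integral>\<^sup>+ u. ennreal (p u) * indicator {x<..y} u \<partial>lborel)"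
      using that by (intro nn_integral_mono)
        (auto simp: indicator_def intro!: ennreal_leI monotone_onD[OF anti])
    also have "\<dots> = ennreal (measure ?D {x<..y})"
      by (simp add: emeasure_eq_measure[symmetric] emeasure_density)
    finally show ?thesis by simp
  qed
  have upper: "measure ?D {x<..y} \<le> p x * (y - x)" if "a \<le> x" "x \<le> y" for x y
  proof -
    have "ennreal (measure ?D {x<..y}) = (\<integral>\<^sup>+ u. ennreal (p u) * indicator {x<..y} u \<partial>lborel)"
      by (simp add: emeasure_eq_measure[symmetric] emeasure_density)
    also have "\<dots> \<le> (\<integral>\<^sup>+ u. ennreal (p x) * indicator {x<..y} u \<partial>lborel)"
      using that by (intro nn_integral_mono)
        (auto simp: indicator_def intro!: ennreal_leI monotone_onD[OF anti])
    also have "\<dots> = ennreal (p x * (y - x))"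
      using that nonneg by (simp add: nn_integral_cmult ennreal_mult)
    finally show ?thesis
      using that nonneg by simp
  qed
  fix x z assume xz: "x \<in> {a..}" "z \<in> {a..}"
  show "measure ?D {z<..} + - p z * (x - z) \<le> measure ?D {x<..}"
  proof (cases "x \<le> z")
    case True
    with xz have "p z * (z - x) \<le> measure ?D {x<..} - measure ?D {z<..}"
      by (subst diff) (auto intro: lower)
    then show ?thesis by (simp add: right_diff_distrib)
  next
    case False
    with xz have "measure ?D {z<..} - measure ?D {x<..} \<le> p z * (x - z)"
      by (subst diff) (auto intro: upper)
    then show ?thesis by (simp add: right_diff_distrib)
  qed
qed simp

lemma greaterThan_or_atLeast_of_up_closed:
  fixes U :: "real set"
  assumes "U \<noteq> {}" and "bdd_below U" and up: "\<And>x y. x \<in> U \<Longrightarrow> x \<le> y \<Longrightarrow> y \<in> U"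
  shows "U = {Inf U<..} \<or> U = {Inf U..}"
proof -
  have "{Inf U<..} \<subseteq> U"
  proof
    fix y assume "y \<in> {Inf U<..}"
    then obtain x where "x \<in> U" "x < y"
      using assms(1,2) by (auto simp: cInf_less_iff)
    then show "y \<in> U" by (auto intro: up)
  qed
  moreover have "U \<subseteq> {Inf U..}"
    using assms by (auto intro: cInf_lower)
  ultimately show ?thesis
    by (metis atLeast_iff greaterThan_iff less_eq_real_def subsetD subsetI subset_antisym)
qed

text \<open>
  The measure has a density, so it does not matter whether the ray \<open>U\<close> contains its endpoint, and the
  function is a translate of the tail.  The condition \<open>U \<subseteq> {0..}\<close> makes the translation
  nonnegative; it keeps the argument in the region where \<open>p\<close> is non-increasing.
\<close>
lemma convex_on_prob_shift_up_closed:
  fixes p :: "real \<Rightarrow> real"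
  assumes "finite_measure (density lborel p)" and [measurable]: "p \<in> borel_measurable borel"
    and "\<And>x. 0 \<le> p x" and "antimono_on {a..} p"
    and U: "U \<subseteq> {0..}" and up: "\<And>x y. x \<in> U \<Longrightarrow> x \<le> y \<Longrightarrow> y \<in> U"
  shows "convex_on {a..} (\<lambda>s. measure (density lborel p) {f. f - s \<in> U})"
proof (cases "U = {}")
  case True
  then show ?thesis by (simp add: convex_on_const)
next
  case False
  let ?D = "density lborel p"
  interpret finite_measure ?D by fact
  define c where "c = Inf U"
  have bdd: "bdd_below U"
    using U by (rule bdd_below_mono[rotated]) simp
  have nn: "0 \<le> c"
    unfolding c_def using U False by (intro cInf_greatest) auto
  have atLeast_eq: "measure ?D {x..} = measure ?D {x<..}" for x
  proof -
    have "{x..} = insert x {x<..}" by auto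
    moreover have "AE y in lborel. y \<in> {x} \<longrightarrow> ennreal (p y) = 0"
      using AE_lborel_singleton[of x] by eventually_elim simp
    then have "{x} \<in> null_sets ?D"
      by (intro null_sets_density_iff[THEN iffD2] conjI) auto
    ultimately have "emeasure ?D {x..} = emeasure ?D {x<..}"
      using emeasure_Un_null_set[of "{x<..}" ?D "{x}"] by simp
    then show ?thesis by (simp add: measure_def)
  qed
  have "measure ?D {f. f - s \<in> U} = measure ?D {s + c<..}" for s
    using greaterThan_or_atLeast_of_up_closed[OF False bdd up] unfolding c_def[symmetric]
  proof
    assume "U = {c<..}"
    then have "{f. f - s \<in> U} = {s + c<..}"
      by auto
    then show ?thesis by simp
  next
    assume "U = {c..}"
    then have "{f. f - s \<in> U} = {s + c..}"
      by auto
    then show ?thesis by (simp add: atLeast_eq)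
  qed
  moreover have "convex_on {a..} (\<lambda>s. measure ?D {s + c<..})"
  proof (rule convex_onI)
    fix t x y :: real
    assume *: "0 < t" "t < 1" "x \<in> {a..}" "y \<in> {a..}"
    have "(1 - t) *\<^sub>R x + t *\<^sub>R y + c = (1 - t) *\<^sub>R (x + c) + t *\<^sub>R (y + c)"
      by (simp add: algebra_simps)
    with * nn show "measure ?D {(1 - t) *\<^sub>R x + t *\<^sub>R y + c<..}
        \<le> (1 - t) * measure ?D {x + c<..} + t * measure ?D {y + c<..}"
      using convex_onD[OF convex_on_tail[OF assms(1-4)], of t "x + c" "y + c"] by simp
  qed simp
  ultimately show ?thesis by simp
qed

section \<open>Monotonicity, concavity and convexity of the expectation\<close>

theorem claim3:
  fixes a b :: real and p V :: "real \<Rightarrow> real"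
  assumes "0 \<le> a" and "a < b"
    and "prob_density_on p a b" and "antimono_on {a..b} p"
    and "V \<in> {0..} \<rightarrow> {0..}" and "mono_on {0..} V" and "concave_on {0..} V" and "V 0 = 0"
  shows "antimono_on {0..b} (\<K> p V) \<and> concave_on {0..a} (\<K> p V) \<and> convex_on {a..b} (\<K> p V)"
proof (intro conjI)
  let ?D = "density lborel p"
  define W where "W x = V (max x 0)" for x
  interpret prob_space ?D by (rule prob_space_density_on[OF assms(3)])
  have [measurable]: "p \<in> borel_measurable borel" and p_nonneg: "\<And>x. 0 \<le> p x"
    and supp: "\<And>x. x \<notin> {a..b} \<Longrightarrow> p x = 0"
    using assms(3) by (auto simp: prob_density_on_def)
  have V_nonneg: "\<And>x. 0 \<le> x \<Longrightarrow> 0 \<le> V x"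
    using assms(5) by auto
  have W_nonneg: "0 \<le> W x" for x
    by (simp add: W_def V_nonneg)
  have W_mono: "x \<le> y \<Longrightarrow> W x \<le> W y" for x y
    unfolding W_def by (intro mono_onD[OF assms(6)]) auto
  have K: "\<K> p V s = expectation (\<lambda>f. W (f - s))" for s
    by (simp add: \<K>_def W_def)
  have int: "integrable ?D (\<lambda>f. W (f - s))" for s
    unfolding W_def by (rule integrable_V_pos_part[OF assms(3,6) V_nonneg])
  have AE_supp: "AE f in ?D. f \<in> {a..b}"
    by (subst AE_density, measurable, rule AE_I2) (use supp in fastforce)
  show "antimono_on {0..b} (\<K> p V)"
    unfolding K by (intro monotone_onI integral_mono int W_mono) simp
  show "concave_on {0..a} (\<K> p V)"
    unfolding concave_on_def
  proof (rule convex_onI)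
    fix t x y :: real
    assume t: "0 < t" "t < 1" and xy: "x \<in> {0..a}" "y \<in> {0..a}"
    let ?z = "(1 - t) *\<^sub>R x + t *\<^sub>R y"
    have "?z \<in> {0..a}"
      using t xy by (intro convexD) auto
    have "(1 - t) * \<K> p V x + t * \<K> p V y = expectation (\<lambda>f. (1 - t) * W (f - x) + t * W (f - y))"
      by (simp add: K int)
    also have "\<dots> \<le> expectation (\<lambda>f. W (f - ?z))"
    proof (rule integral_mono_AE)
      show "AE f in ?D. (1 - t) * W (f - x) + t * W (f - y) \<le> W (f - ?z)"
        using AE_supp
      proof eventually_elim
        case (elim f)
        have "(1 - t) * V (f - x) + t * V (f - y) \<le> V ((1 - t) *\<^sub>R (f - x) + t *\<^sub>R (f - y))"
          using concave_onD[OF assms(7), of t "f - x" "f - y"] t xy elim by simp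
        moreover have "(1 - t) *\<^sub>R (f - x) + t *\<^sub>R (f - y) = f - ?z"
          by (simp add: algebra_simps)
        ultimately show ?case
          using xy elim \<open>?z \<in> {0..a}\<close> by (simp add: W_def)
      qed
    qed (simp_all add: int)
    finally show "- \<K> p V ?z \<le> (1 - t) * - \<K> p V x + t * - \<K> p V y"
      by (simp add: K)
  qed simp
  \<comment> \<open>The density drops to zero at \<open>b\<close>, so there is no right end to take care of.\<close>
  have anti: "antimono_on {a..} p"
  proof (rule monotone_onI)
    fix x y assume "x \<in> {a..}" "y \<in> {a..}" "x \<le> y"
    then show "p x \<ge> p y"
      using supp[of y] p_nonneg[of x] monotone_onD[OF assms(4), of x y] by (cases "y \<le> b") auto
  qed
  define h where "h t s = measure ?D {f. t < W (f - s)}" for t s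
  have [measurable]: "W \<in> borel_measurable borel"
    by (rule borel_measurable_mono) (auto intro: monoI W_mono)
  have h_convex: "convex_on {a..} (h t)" if "0 \<le> t" for t
  proof -
    have "W x = 0" if "x \<le> 0" for x
      using that assms(8) by (simp add: W_def)
    with \<open>0 \<le> t\<close> have "\<not> t < W x" if "x \<le> 0" for x
      using that by simp
    then have "{x. t < W x} \<subseteq> {0..}"
      by (auto intro: leI less_imp_le)
    then have "convex_on {a..} (\<lambda>s. measure ?D {f. f - s \<in> {x. t < W x}})"
      by (intro convex_on_prob_shift_up_closed finite_measure_axioms p_nonneg anti)
        (auto intro: less_le_trans W_mono)
    then show ?thesis by (simp add: h_def[abs_def])
  qed
  have K_layer: "ennreal (\<K> p V s) = (\<integral>\<^sup>+ t. ennreal (h t s) * indicator {0..} t \<partial>lborel)" for s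
  proof -
    have "ennreal (\<K> p V s) = (\<integral>\<^sup>+ f. ennreal (W (f - s)) \<partial>?D)"
      unfolding K by (rule nn_integral_eq_integral[symmetric]) (simp_all add: int W_nonneg)
    also have "\<dots> = (\<integral>\<^sup>+ t. emeasure ?D {f \<in> space ?D. t < W (f - s)} * indicator {0..} t \<partial>lborel)"
      by (rule nn_integral_layer_cake) (simp_all add: W_nonneg sigma_finite_measure_axioms)
    finally show ?thesis
      by (simp add: h_def emeasure_eq_measure)
  qed
  have [measurable]: "(\<lambda>t. h t s) \<in> borel_measurable borel" for s
  proof -
    have "mono (\<lambda>t. - h t s)"
      unfolding h_def by (intro monoI) (auto intro!: finite_measure_mono)
    then have "(\<lambda>t. - (- h t s)) \<in> borel_measurable borel"
      by (intro borel_measurable_uminus borel_measurable_mono)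
    then show ?thesis by simp
  qed
  have K_nonneg: "0 \<le> \<K> p V s" for s
    by (rule \<K>_nonneg[OF V_nonneg])
  show "convex_on {a..b} (\<K> p V)"
  proof (rule convex_onI)
    fix t x y :: real
    assume t: "0 < t" "t < 1" and xy: "x \<in> {a..b}" "y \<in> {a..b}"
    let ?z = "(1 - t) *\<^sub>R x + t *\<^sub>R y"
    have "ennreal (\<K> p V ?z) = (\<integral>\<^sup>+ r. ennreal (h r ?z) * indicator {0..} r \<partial>lborel)"
      by (rule K_layer)
    also have "\<dots> \<le> (\<integral>\<^sup>+ r. ennreal (1 - t) * (ennreal (h r x) * indicator {0..} r)
        + ennreal t * (ennreal (h r y) * indicator {0..} r) \<partial>lborel)"
    proof (rule nn_integral_mono)
      fix r :: real
      have "ennreal (h r ?z) \<le> ennreal (1 - t) * ennreal (h r x) + ennreal t * ennreal (h r y)"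
        if "0 \<le> r"
      proof -
        have "h r ?z \<le> (1 - t) * h r x + t * h r y"
          using convex_onD[OF h_convex[OF that], of t x y] t xy by simp
        then show ?thesis
          using t by (simp add: h_def ennreal_mult[symmetric] ennreal_plus[symmetric] ennreal_leI
              del: ennreal_plus)
      qed
      then show "ennreal (h r ?z) * indicator {0..} r \<le> ennreal (1 - t) * (ennreal (h r x) * indicator {0..} r)
          + ennreal t * (ennreal (h r y) * indicator {0..} r)"
        by (auto simp: indicator_def)
    qed
    also have "\<dots> = ennreal (1 - t) * ennreal (\<K> p V x) + ennreal t * ennreal (\<K> p V y)"
      by (simp add: nn_integral_add nn_integral_cmult K_layer)
    also have "\<dots> = ennreal ((1 - t) * \<K> p V x + t * \<K> p V y)"
      using t K_nonneg by (simp add: ennreal_mult)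
    finally show "\<K> p V ?z \<le> (1 - t) * \<K> p V x + t * \<K> p V y"
      using t by (subst (asm) ennreal_le_iff) (simp_all add: K_nonneg)
  qed simp
qed

end
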